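(* A social network $(G,P,p,\theta)$ admits a unique outcome if and only if its contraction sequence ends in a network that is not ambivalent given $p$.
   Context: Setting. $G=(V,E)$ is a finite weighted directed graph with no parallel edges and no self-loops, $n=|V|$, and each edge $(i,j)$ has a weight $w_{ij}\in[0,1]$. For a node $i$, $N(i)$ is the set of nodes $j$ with an edge $(j,i)\in E$ (the neighbours of $i$). It is assumed that $\sum_{j\in N(i)} w_{ji}\le 1$ for every node $i$ with $N(i)\ne\emptyset$. The threshold function $\theta$ assigns to each node $i$ a value $\theta(i)\in(0,1]$. $P$ is a finite set of products. A social network is a tuple $(G,P,p,\theta)$ where $p$ assigns to each node a non-empty subset of $P$; since $G,P,\theta$ are fixed, a social network is identified with $p$. Reductions. For a product $t$ and a node $i$, the adoption condition $A(t,i)$ holds in $p$ if $N(i)=\emptyset$, or if $N(i)\neq\emptyset$ and $\sum_{j\in N(i)\mid p(j)=\{t\}} w_{ji}\ge\theta(i)$. Write $p_1\to p_2$ if $p_2\ne p_1$ and for all nodes $i$ with $p_2(i)\ne p_1(i)$ we have $|p_1(i)|\ge 2$ and, for some $t\in p_1(i)$, $p_2(i)=\{t\}$ and $A(t,i)$ holds in $p_1$. Let $\to^*$ be the reflexive, transitive closure of $\to$. A reduction sequence $p\to^* p'$ is maximal if there is no $p''$ with $p'\to p''$. A network $p'$ is unavoidable from $p$ if for all maximal reduction sequences $p\to^* p''$ we have $p'=p''$. The network $p$ has (admits) a unique outcome if some social network is unavoidable from $p$. Node $i$ adopted product $t$ in $p$ if $p(i)=\{t\}$; node $i$ can adopt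 product $t$ in $p$ if $t\in p(i)$, $|p(i)|\ge 2$ and $A(t,i)$ holds in $p$. Given social networks $p,p'$ on the same graph: node $i$ can switch in $p'$ given $p$ if $i$ adopted in $p'$ a product $t$ and for some $t'\ne t$ we have $t'\in p(i)$ and $A(t',i)$ holds in $p'$. The network $p'$ is ambivalent given $p$ if it contains a node that either can adopt more than one product in $p'$ or can switch in $p'$ given $p$. A reduction $p\to p'$ is fast if each node $i$ that can adopt a product in $p$ adopted a product in $p'$. The contraction sequence of a social network $p$ is the unique reduction sequence $p\to^* p'$ (possibly of length zero) such that each of its reduction steps is fast, and either $p\to^* p'$ is maximal or $p'$ is the first network in the sequence that is ambivalent given $p$ (so no network in the sequence before the last one is ambivalent given $p$). *)

theory Defs
  imports Complex_Main "HOL-Library.FuncSet" "Graph_Theory.Pair_Digraph"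
begin

text \<open>
  The graph, the edge weights, the threshold function and the set of products are fixed by the
  locale.  An edge \<open>(j, i)\<close> points from the neighbour \<open>j\<close> to the node \<open>i\<close> that it influences.
\<close>

locale threshold_setting = pair_digraph G
  for G :: "'v pair_pre_digraph" +
  fixes w :: "'v \<times> 'v \<Rightarrow> real"
    and \<theta> :: "'v \<Rightarrow> real"
    and P :: "'p set"
  assumes weight_range: "e \<in> parcs G \<Longrightarrow> w e \<in> {0..1}"
    and weight_sum_le_1:
      "i \<in> pverts G \<Longrightarrow> {j. (j, i) \<in> parcs G} \<noteq> {} \<Longrightarrow> (\<Sum>j | (j, i) \<in> parcs G. w (j, i)) \<le> 1"
    and threshold_range: "i \<in> pverts G \<Longrightarrow> \<theta> i \<in> {0<..1}"
    and finite_products: "finite P"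
begin

definition neighbours :: "'v \<Rightarrow> 'v set" where
  "neighbours i = {j. (j, i) \<in> parcs G}"

text \<open>
  Networks are extensional functions on the vertex set, so that HOL equality of networks is
  equality at all nodes.
\<close>

definition social_networks :: "('v \<Rightarrow> 'p set) set" where
  "social_networks = pverts G \<rightarrow>\<^sub>E (Pow P - {{}})"

definition adoption_condition :: "('v \<Rightarrow> 'p set) \<Rightarrow> 'p \<Rightarrow> 'v \<Rightarrow> bool" where
  "adoption_condition p t i \<longleftrightarrow>
     neighbours i = {} \<or>
     (neighbours i \<noteq> {} \<and> (\<Sum>j | j \<in> neighbours i \<and> p j = {t}. w (j, i)) \<ge> \<theta> i)"

definition reduces :: "('v \<Rightarrow> 'p set) \<Rightarrow> ('v \<Rightarrow> 'p set) \<Rightarrow> bool" where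
  "reduces p q \<longleftrightarrow> p \<in> social_networks \<and> q \<in> social_networks \<and> q \<noteq> p \<and>
     (\<forall>i\<in>pverts G. q i \<noteq> p i \<longrightarrow>
        card (p i) \<ge> 2 \<and> (\<exists>t\<in>p i. q i = {t} \<and> adoption_condition p t i))"

definition irreducible_network :: "('v \<Rightarrow> 'p set) \<Rightarrow> bool" where
  "irreducible_network p \<longleftrightarrow> \<not> (\<exists>q. reduces p q)"

text \<open>
  Whether a reduction sequence is maximal depends only on its last network, so quantifying over
  maximal reduction sequences amounts to quantifying over reachable irreducible networks.
\<close>

definition unavoidable :: "('v \<Rightarrow> 'p set) \<Rightarrow> ('v \<Rightarrow> 'p set) \<Rightarrow> bool" where
  "unavoidable p q \<longleftrightarrow> (\<forall>r. reduces\<^sup>*\<^sup>* p r \<and> irreducible_network r \<longrightarrow> q = r)"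

definition unique_outcome :: "('v \<Rightarrow> 'p set) \<Rightarrow> bool" where
  "unique_outcome p \<longleftrightarrow> (\<exists>q\<in>social_networks. unavoidable p q)"

definition adopted :: "('v \<Rightarrow> 'p set) \<Rightarrow> 'v \<Rightarrow> 'p \<Rightarrow> bool" where
  "adopted p i t \<longleftrightarrow> p i = {t}"

definition can_adopt :: "('v \<Rightarrow> 'p set) \<Rightarrow> 'v \<Rightarrow> 'p \<Rightarrow> bool" where
  "can_adopt p i t \<longleftrightarrow> t \<in> p i \<and> card (p i) \<ge> 2 \<and> adoption_condition p t i"

text \<open>In the next two definitions \<open>p\<close> is the given network and \<open>q\<close> the network in question.\<close>

definition can_switch :: "('v \<Rightarrow> 'p set) \<Rightarrow> ('v \<Rightarrow> 'p set) \<Rightarrow> 'v \<Rightarrow> bool" where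
  "can_switch p q i \<longleftrightarrow>
     (\<exists>t. adopted q i t \<and> (\<exists>t'. t' \<noteq> t \<and> t' \<in> p i \<and> adoption_condition q t' i))"

definition ambivalent :: "('v \<Rightarrow> 'p set) \<Rightarrow> ('v \<Rightarrow> 'p set) \<Rightarrow> bool" where
  "ambivalent p q \<longleftrightarrow>
     (\<exists>i\<in>pverts G. (\<exists>t t'. t \<noteq> t' \<and> can_adopt q i t \<and> can_adopt q i t') \<or> can_switch p q i)"

definition fast_reduces :: "('v \<Rightarrow> 'p set) \<Rightarrow> ('v \<Rightarrow> 'p set) \<Rightarrow> bool" where
  "fast_reduces p q \<longleftrightarrow> reduces p q \<and>
     (\<forall>i\<in>pverts G. (\<exists>t. can_adopt p i t) \<longrightarrow> (\<exists>t. adopted q i t))"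

text \<open>A reduction sequence is represented by the nonempty list of its networks.\<close>

definition is_contraction_sequence :: "('v \<Rightarrow> 'p set) \<Rightarrow> ('v \<Rightarrow> 'p set) list \<Rightarrow> bool" where
  "is_contraction_sequence p qs \<longleftrightarrow>
     qs \<noteq> [] \<and> hd qs = p \<and> successively fast_reduces qs \<and>
     (irreducible_network (last qs) \<or> ambivalent p (last qs)) \<and>
     (\<forall>q\<in>set (butlast qs). \<not> ambivalent p q)"

text \<open>Existence and uniqueness are shown in \<open>contraction_sequence_ex1\<close> below.\<close>

definition contraction_sequence :: "('v \<Rightarrow> 'p set) \<Rightarrow> ('v \<Rightarrow> 'p set) list" where
  "contraction_sequence p = (THE qs. is_contraction_sequence p qs)"

lemma fast_reduces_unique:
  assumes na: "\<not> ambivalent p q" and r: "fast_reduces q r" and s: "fast_reduces q s"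
  shows "r = s"
proof (rule ext)
  have rn: "r \<in> social_networks" and sn: "s \<in> social_networks"
    using r s by (auto simp: fast_reduces_def reduces_def)
  fix i show "r i = s i"
  proof (cases "i \<in> pverts G")
    case False
    then show ?thesis using rn sn by (auto simp: social_networks_def PiE_def extensional_def)
  next
    case i: True
    have step: "x i = {t}" if x: "fast_reduces q x" and t: "can_adopt q i t" for x t
    proof -
      obtain u where u: "x i = {u}" using x t i by (auto simp: fast_reduces_def adopted_def)
      then have "card (x i) = 1" by simp
      then have "x i \<noteq> q i" using t by (auto simp: can_adopt_def)
      then have "can_adopt q i u"
        using x i u by (auto simp: fast_reduces_def reduces_def can_adopt_def)
      then show ?thesis using na t i u unfolding ambivalent_def by metis
    qed
    have stay: "x i = q i" if x: "fast_reduces q x" and t: "\<nexists>t. can_adopt q i t" for x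
      using x t i by (auto simp: fast_reduces_def reduces_def can_adopt_def)
    show ?thesis using step stay r s by metis
  qed
qed

lemma fast_reduces_exists:
  assumes "\<not> irreducible_network q"
  shows "\<exists>r. fast_reduces q r"
proof -
  obtain r0 where r0: "reduces q r0" using assms by (auto simp: irreducible_network_def)
  then have q: "q \<in> social_networks" by (simp add: reduces_def)
  have "\<exists>i\<in>pverts G. r0 i \<noteq> q i"
  proof (rule ccontr)
    assume "\<not> ?thesis"
    then have "r0 = q" using r0
      by (intro PiE_ext[of r0 "pverts G" "\<lambda>_. Pow P - {{}}" q])
         (auto simp: reduces_def social_networks_def)
    then show False using r0 by (simp add: reduces_def)
  qed
  then have "\<exists>i\<in>pverts G. \<exists>u. can_adopt q i u"
    using r0 unfolding reduces_def can_adopt_def by metis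
  then obtain i u where i: "i \<in> pverts G" "can_adopt q i u" by blast
  define r where "r = (\<lambda>i. if i \<in> pverts G \<and> (\<exists>t. can_adopt q i t)
                            then {SOME t. can_adopt q i t} else q i)"
  have some: "can_adopt q i (SOME t. can_adopt q i t)" if "can_adopt q i t" for i t
    using that by (rule someI)
  have "r \<in> social_networks"
    using q some
    by (fastforce simp: social_networks_def r_def PiE_iff extensional_def can_adopt_def)
  moreover have "r \<noteq> q"
  proof
    assume "r = q"
    have "r i = {SOME t. can_adopt q i t}" using i by (auto simp: r_def)
    then have "card (q i) = 1" using \<open>r = q\<close> by simp
    then show False using i by (simp add: can_adopt_def)
  qed
  ultimately have "reduces q r"
    unfolding reduces_def
  proof (intro conjI ballI impI)
    fix j assume "j \<in> pverts G" "r j \<noteq> q j"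
    then have "r j = {SOME t. can_adopt q j t}" "can_adopt q j (SOME t. can_adopt q j t)"
      using some by (auto simp: r_def split: if_splits)
    then show "2 \<le> card (q j)" "\<exists>t\<in>q j. r j = {t} \<and> adoption_condition q t j"
      by (auto simp: can_adopt_def)
  qed (use q in auto)
  then have "fast_reduces q r" by (auto simp: fast_reduces_def r_def adopted_def)
  then show ?thesis by blast
qed

lemma reduces_decreases:
  assumes "reduces q r"
  shows "(\<Sum>i\<in>pverts G. card (r i)) < (\<Sum>i\<in>pverts G. card (q i))"
proof (rule sum_strict_mono_ex1)
  show "finite (pverts G)" by (rule pair_finite_verts)
  show "\<forall>i\<in>pverts G. card (r i) \<le> card (q i)"
  proof
    fix i assume "i \<in> pverts G"
    then show "card (r i) \<le> card (q i)"
      using assms by (cases "r i = q i") (auto simp: reduces_def)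
  qed
  have "\<exists>i\<in>pverts G. r i \<noteq> q i"
  proof (rule ccontr)
    assume "\<not> ?thesis"
    then have "r = q" using assms
      by (intro PiE_ext[of r "pverts G" "\<lambda>_. Pow P - {{}}" q])
         (auto simp: reduces_def social_networks_def)
    then show False using assms by (simp add: reduces_def)
  qed
  then obtain i where i: "i \<in> pverts G" "r i \<noteq> q i" by blast
  then have "card (r i) < card (q i)" using assms by (auto simp: reduces_def)
  then show "\<exists>i\<in>pverts G. card (r i) < card (q i)" using i by blast
qed

theorem contraction_sequence_ex1: "\<exists>!qs. is_contraction_sequence p qs"
proof -
  define C where "C q qs \<longleftrightarrow> qs \<noteq> [] \<and> hd qs = q \<and> successively fast_reduces qs \<and>
     (irreducible_network (last qs) \<or> ambivalent p (last qs)) \<and>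
     (\<forall>q\<in>set (butlast qs). \<not> ambivalent p q)" for q qs
  have "\<exists>!qs. C q qs" for q
  proof (induction "\<Sum>i\<in>pverts G. card (q i)" arbitrary: q rule: less_induct)
    case less
    show ?case
    proof (cases "irreducible_network q \<or> ambivalent p q")
      case True
      have "C q [q]" using True by (simp add: C_def)
      moreover have "qs = [q]" if c: "C q qs" for qs
      proof (cases qs)
        case Nil then show ?thesis using c by (simp add: C_def)
      next
        case (Cons a rs)
        then have a: "qs = q # rs" using c by (simp add: C_def)
        have "rs = []"
        proof (rule ccontr)
          assume "rs \<noteq> []"
          then have "fast_reduces q (hd rs)" "\<not> ambivalent p q"
            using c a by (auto simp: C_def successively_Cons)
          then show False using True by (auto simp: irreducible_network_def fast_reduces_def)
        qed
        then show ?thesis using a by simp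
      qed
      ultimately show ?thesis by blast
    next
      case False
      then obtain r where r: "fast_reduces q r" using fast_reduces_exists by blast
      have "\<exists>!rs. C r rs"
        using less reduces_decreases r by (simp add: fast_reduces_def)
      then obtain rs where rs: "C r rs" and un: "\<And>ss. C r ss \<Longrightarrow> ss = rs" by blast
      have "C q (q # rs)" using rs r False by (auto simp: C_def successively_Cons)
      moreover have "qs = q # rs" if c: "C q qs" for qs
      proof -
        obtain ss where a: "qs = q # ss" using c by (cases qs) (auto simp: C_def)
        have ne: "ss \<noteq> []" using c a False by (auto simp: C_def)
        then have "fast_reduces q (hd ss)" using c a by (auto simp: C_def successively_Cons)
        then have "hd ss = r" using fast_reduces_unique r False by blast
        then have "C r ss" using c a ne by (auto simp: C_def successively_Cons)
        then show ?thesis using un a by simp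
      qed
      ultimately show ?thesis by blast
    qed
  qed
  then show ?thesis unfolding C_def is_contraction_sequence_def by blast
qed

end

end

(* If the last network q of the contraction sequence is not ambivalent, then q is irreducible and
   no node can switch in q.  By induction every network reachable from p then only makes
   adoptions that q makes; an irreducible one inherits from q that no node can switch,
   so the comparison also holds in the other direction and it equals q.

   Conversely let q be ambivalent.  A node that can adopt two products leads to two outcomes.
   If node i adopted t but could switch to t', observe that adoptions of t' only depend on earlier
   adoptions of t': keeping only these yields a network reachable from p in which i can
   still adopt t', which leads to an outcome different from those reached from q. *)

theory Submission
  imports Defs
begin

context threshold_setting
begin

section \<open>Monotonicity of adoption and persistence of changes along reductions\<close>

text \<open>Weights are nonnegative, so further adopters of \<open>t\<close> can only increase the
  sum compared with the threshold.\<close>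

lemma adoption_condition_mono:
  assumes "adoption_condition p t i"
    and "\<And>j. p j = {t} \<Longrightarrow> q j = {t}"
  shows "adoption_condition q t i"
proof (cases "neighbours i = {}")
  case False
  have "neighbours i \<subseteq> fst ` parcs G"
    by (force simp: neighbours_def)
  then have fin: "finite (neighbours i)"
    using pair_finite_arcs finite_surj by blast
  have "(\<Sum>j | j \<in> neighbours i \<and> p j = {t}. w (j, i)) \<le>
      (\<Sum>j | j \<in> neighbours i \<and> q j = {t}. w (j, i))"
    using assms(2) fin weight_range by (intro sum_mono2) (auto simp: neighbours_def)
  then show ?thesis
    using assms(1) False by (auto simp: adoption_condition_def)
qed (simp add: adoption_condition_def)

lemma reduces_change:
  assumes "reduces p q" and "q i \<noteq> p i"
  obtains t where "i \<in> pverts G" "q i = {t}" "can_adopt p i t"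
proof -
  have "i \<in> pverts G"
    using assms by (cases "i \<in> pverts G") (auto simp: reduces_def social_networks_def PiE_def extensional_def)
  then show ?thesis
    using assms that by (auto simp: reduces_def can_adopt_def)
qed

text \<open>A node changes at most once: adopting requires two products and leaves only one.\<close>

lemma reaches_change:
  assumes "reduces\<^sup>*\<^sup>* p q"
  shows "q i = p i \<or> (i \<in> pverts G \<and> card (p i) \<ge> 2 \<and> (\<exists>t\<in>p i. q i = {t}))"
  using assms
proof (induction rule: rtranclp_induct)
  case (step q r)
  show ?case
  proof (cases "r i = q i")
    case False
    then obtain t where t: "i \<in> pverts G" "r i = {t}" "can_adopt q i t"
      using reduces_change step.hyps(2) by blast
    then have "q i = p i"
      using step.IH by (auto simp: can_adopt_def)
    then show ?thesis
      using t by (auto simp: can_adopt_def)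
  qed (use step.IH in simp)
qed simp

lemma reaches_adopted:
  assumes "reduces\<^sup>*\<^sup>* p q" and "p i = {t}"
  shows "q i = {t}"
  using reaches_change[OF assms(1), of i] assms(2) by auto

lemma reaches_social_networks:
  assumes "reduces\<^sup>*\<^sup>* p q" and "p \<in> social_networks"
  shows "q \<in> social_networks"
  using assms by (induction rule: rtranclp_induct) (auto simp: reduces_def)

lemma reduces_fun_upd:
  assumes "p \<in> social_networks" and "i \<in> pverts G" and "can_adopt p i t"
  shows "reduces p (p(i := {t}))"
proof -
  have "p(i := {t}) \<in> social_networks"
    using assms by (fastforce simp: social_networks_def PiE_iff extensional_def can_adopt_def)
  moreover have "p(i := {t}) \<noteq> p"
    using assms(3) by (auto simp: can_adopt_def fun_upd_idem_iff)
  ultimately show ?thesis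
    using assms by (auto simp: reduces_def can_adopt_def)
qed

lemma irreducible_not_can_adopt:
  assumes "irreducible_network p" and "p \<in> social_networks" and "i \<in> pverts G"
  shows "\<not> can_adopt p i t"
  using assms reduces_fun_upd by (auto simp: irreducible_network_def)

lemma reaches_irreducible: "\<exists>r. reduces\<^sup>*\<^sup>* q r \<and> irreducible_network r"
proof (induction "\<Sum>i\<in>pverts G. card (q i)" arbitrary: q rule: less_induct)
  case less
  show ?case
  proof (cases "irreducible_network q")
    case False
    then obtain r where "reduces q r"
      by (auto simp: irreducible_network_def)
    then show ?thesis
      using less[of r] reduces_decreases converse_rtranclp_into_rtranclp by metis
  qed auto
qed

section \<open>Uniqueness of an outcome in which no node can switch\<close>

text \<open>Induction on the steps to \<open>r\<close>: the adopters of \<open>t\<close> so far also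
  adopt it in \<open>q\<close>, so by monotonicity the condition for a new adoption of
  \<open>t\<close> holds in \<open>q\<close> as well. Irreducibility then forces the node to have
  adopted some product in \<open>q\<close>, and stability forces that product to be
  \<open>t\<close>.\<close>

lemma reaches_only_adoptions_of_stable:
  assumes p: "p \<in> social_networks" and q: "reduces\<^sup>*\<^sup>* p q" and irr: "irreducible_network q"
    and stable: "\<And>i. i \<in> pverts G \<Longrightarrow> \<not> can_switch p q i"
    and "reduces\<^sup>*\<^sup>* p r" and "r i = {t}"
  shows "q i = {t}"
  using assms(5,6)
proof (induction arbitrary: i t rule: rtranclp_induct)
  case base
  then show ?case using reaches_adopted q by blast
next
  case (step r s)
  show ?case
  proof (cases "s i = r i")
    case True
    then show ?thesis using step.IH step.prems by metis
  next
    case False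
    then obtain u where i: "i \<in> pverts G" and u: "s i = {u}" "can_adopt r i u"
      by (rule reduces_change[OF step.hyps(2)])
    then have t: "can_adopt r i t"
      using step.prems by simp
    then have "adoption_condition r t i"
      by (simp add: can_adopt_def)
    then have A: "adoption_condition q t i"
      using step.IH by (rule adoption_condition_mono)
    have "r i \<noteq> {v}" for v
      using t by (auto simp: can_adopt_def)
    then have ri: "r i = p i"
      using reaches_change[OF step.hyps(1), of i] by blast
    have "\<not> can_adopt q i t"
      using irreducible_not_can_adopt[OF irr reaches_social_networks[OF q p] i] .
    \<comment> \<open>Otherwise \<open>i\<close> would still hold at least two products in
      \<open>q\<close> and could adopt \<open>t\<close> there.\<close>
    then have "q i \<noteq> p i"
      using A t ri by (auto simp: can_adopt_def)
    then obtain v where v: "q i = {v}"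
      using reaches_change[OF q, of i] by blast
    have "t \<in> p i"
      using t ri by (simp add: can_adopt_def)
    then have "can_switch p q i" if "t \<noteq> v"
      using A v that by (auto simp: can_switch_def adopted_def)
    then have "v = t"
      using stable[OF i] by blast
    then show ?thesis
      using v by simp
  qed
qed

lemma irreducible_eq_stable:
  assumes p: "p \<in> social_networks" and q: "reduces\<^sup>*\<^sup>* p q" and irr: "irreducible_network q"
    and stable: "\<And>i. i \<in> pverts G \<Longrightarrow> \<not> can_switch p q i"
    and r: "reduces\<^sup>*\<^sup>* p r" and irr': "irreducible_network r"
  shows "q = r"
proof
  fix i
  have le: "r j = {t} \<Longrightarrow> q j = {t}" for j t
    using reaches_only_adoptions_of_stable[OF p q irr stable r] by blast
  \<comment> \<open>A switch in \<open>r\<close> would be a switch in \<open>q\<close>: by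
    \<open>le\<close> both the adopted product and the condition for the other one carry
    over.\<close>
  have "\<not> can_switch p r j" if "j \<in> pverts G" for j
    using stable[OF that] le adoption_condition_mono[where p = r and q = q]
    unfolding can_switch_def adopted_def by metis
  then have "q j = {t} \<Longrightarrow> r j = {t}" for j t
    using reaches_only_adoptions_of_stable[OF p r irr' _ q] by blast
  \<comment> \<open>The adopters agree, and a node that has changed in neither network keeps
    \<open>p i\<close> in both.\<close>
  then show "q i = r i"
    using le reaches_change[OF q, of i] reaches_change[OF r, of i] by metis
qed

section \<open>Ambivalence excludes a unique outcome\<close>

text \<open>Adoptions persist up to an irreducible network, so an unavoidable network would have to
  assign both \<open>{t}\<close> and \<open>{t'}\<close> to \<open>i\<close>.\<close>

lemma not_unique_outcomeI:
  assumes q: "reduces\<^sup>*\<^sup>* p q" "q i = {t}" and r: "reduces\<^sup>*\<^sup>* p r" "r i = {t'}" and "t \<noteq> t'"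
  shows "\<not> unique_outcome p"
proof
  assume "unique_outcome p"
  then obtain z where z: "unavoidable p z"
    by (auto simp: unique_outcome_def)
  have "z i = {u}" if "reduces\<^sup>*\<^sup>* p s" "s i = {u}" for s u
  proof -
    obtain s' where s': "reduces\<^sup>*\<^sup>* s s'" "irreducible_network s'"
      using reaches_irreducible by blast
    then have "z = s'"
      using z that rtranclp_trans[of reduces p s s'] by (auto simp: unavoidable_def)
    then show ?thesis
      using reaches_adopted s' that by blast
  qed
  then show False
    using assms by (metis singleton_inject)
qed

definition keep_adoptions :: "'p \<Rightarrow> ('v \<Rightarrow> 'p set) \<Rightarrow> ('v \<Rightarrow> 'p set) \<Rightarrow> 'v \<Rightarrow> 'p set" where
  "keep_adoptions t p q = (\<lambda>i. if q i = {t} then {t} else p i)"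

lemma keep_adoptions_social_networks:
  assumes "p \<in> social_networks" and "q \<in> social_networks"
  shows "keep_adoptions t p q \<in> social_networks"
  using assms by (fastforce simp: social_networks_def keep_adoptions_def PiE_iff extensional_def)

lemma keep_adoptions_adopted_iff:
  assumes "reduces\<^sup>*\<^sup>* p q"
  shows "keep_adoptions t p q i = {t} \<longleftrightarrow> q i = {t}"
  using reaches_adopted[OF assms] by (auto simp: keep_adoptions_def)

lemma adoption_condition_keep_adoptions:
  assumes "reduces\<^sup>*\<^sup>* p q" and "adoption_condition q t i"
  shows "adoption_condition (keep_adoptions t p q) t i"
  using adoption_condition_mono[OF assms(2)] keep_adoptions_adopted_iff[OF assms(1)] by blast

text \<open>The adoptions of \<open>t\<close> are replayed alone. The condition for \<open>t\<close>
  depends only on the adopters of \<open>t\<close>, and these are the same in \<open>q\<close> and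
  in its image.\<close>

lemma reaches_keep_adoptions:
  assumes "reduces\<^sup>*\<^sup>* p q" and p: "p \<in> social_networks"
  shows "reduces\<^sup>*\<^sup>* p (keep_adoptions t p q)"
  using assms(1)
proof (induction rule: rtranclp_induct)
  case base
  have "keep_adoptions t p p = p"
    by (auto simp: keep_adoptions_def)
  then show ?case by simp
next
  case (step q r)
  let ?q = "keep_adoptions t p q" and ?r = "keep_adoptions t p r"
  have q: "q \<in> social_networks" and r: "r \<in> social_networks"
    using step.hyps(2) by (auto simp: reduces_def)
  have "card (?q i) \<ge> 2 \<and> (\<exists>u\<in>?q i. ?r i = {u} \<and> adoption_condition ?q u i)"
    if neq: "?r i \<noteq> ?q i" for i
  proof -
    \<comment> \<open>The images differ only where this step newly adopts \<open>t\<close>, since an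
      earlier adoption of \<open>t\<close> is never undone.\<close>
    have ri: "r i = {t}" "q i \<noteq> {t}"
      using neq reaches_adopted[of q r i t] step.hyps(2)
      by (auto simp: keep_adoptions_def split: if_splits)
    then have t: "can_adopt q i t"
      using reduces_change[OF step.hyps(2), of i] by force
    then have "?q i = q i"
      using reaches_change[OF step.hyps(1), of i] ri by (auto simp: keep_adoptions_def can_adopt_def)
    then show ?thesis
      using t ri adoption_condition_keep_adoptions[OF step.hyps(1)]
      by (auto simp: keep_adoptions_def can_adopt_def)
  qed
  \<comment> \<open>The images coincide when the step contains no adoption of
    \<open>t\<close>.\<close>
  then have "?r = ?q \<or> reduces ?q ?r"
    using keep_adoptions_social_networks p q r by (auto simp: reduces_def)
  then show ?case
    using step.IH by (auto intro: rtranclp.rtrancl_into_rtrancl)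
qed

lemma ambivalent_not_unique_outcome:
  assumes p: "p \<in> social_networks" and q: "reduces\<^sup>*\<^sup>* p q" and "ambivalent p q"
  shows "\<not> unique_outcome p"
proof -
  obtain i where i: "i \<in> pverts G"
    and "(\<exists>t t'. t \<noteq> t' \<and> can_adopt q i t \<and> can_adopt q i t') \<or> can_switch p q i"
    using assms(3) by (auto simp: ambivalent_def)
  then consider (adopt) t t' where "t \<noteq> t'" "can_adopt q i t" "can_adopt q i t'"
    | (switch) "can_switch p q i" by blast
  then show ?thesis
  proof cases
    case adopt
    have "reduces\<^sup>*\<^sup>* p (q(i := {u}))" if "can_adopt q i u" for u
      using reduces_fun_upd[OF reaches_social_networks[OF q p] i that] q by simp
    then show ?thesis
      using adopt not_unique_outcomeI[of p "q(i := {t})" i t "q(i := {t'})" t'] by simp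
  next
    case switch
    then obtain t t' where t: "q i = {t}" and t': "t' \<noteq> t" "t' \<in> p i" "adoption_condition q t' i"
      by (auto simp: can_switch_def adopted_def)
    let ?k = "keep_adoptions t' p q"
    \<comment> \<open>Since \<open>t'\<close> is in \<open>p i\<close> but not in
      \<open>q i\<close>, node \<open>i\<close> has changed on the way to \<open>q\<close>.\<close>
    have "card (p i) \<ge> 2"
      using reaches_change[OF q, of i] t t' by auto
    \<comment> \<open>As \<open>q i = {t}\<close> with \<open>t\<close> distinct from
      \<open>t'\<close>, the adoption at \<open>i\<close> is dropped and
      \<open>?k i = p i\<close>.\<close>
    then have "can_adopt ?k i t'"
      using t t' adoption_condition_keep_adoptions[OF q]
      by (auto simp: can_adopt_def keep_adoptions_def)
    then have "reduces ?k (?k(i := {t'}))"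
      using reduces_fun_upd keep_adoptions_social_networks p reaches_social_networks[OF q p] i
      by blast
    then have "reduces\<^sup>*\<^sup>* p (?k(i := {t'}))"
      using reaches_keep_adoptions[OF q p] by (rule rtranclp.rtrancl_into_rtrancl[rotated])
    then show ?thesis
      using not_unique_outcomeI[OF q t] t' by auto
  qed
qed

section \<open>The end of the contraction sequence decides\<close>

lemma successively_rtranclp:
  assumes "successively R xs" and "xs \<noteq> []"
  shows "R\<^sup>*\<^sup>* (hd xs) (last xs)"
  using assms
  by (induction xs) (auto simp: successively_Cons intro: converse_rtranclp_into_rtranclp)

lemma unique_outcome_iff_contraction_sequence:
  assumes p: "p \<in> social_networks"
  shows "unique_outcome p \<longleftrightarrow> \<not> ambivalent p (last (contraction_sequence p))"
proof -
  define q where "q = last (contraction_sequence p)"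
  have cs: "is_contraction_sequence p (contraction_sequence p)"
    unfolding contraction_sequence_def using contraction_sequence_ex1 by (rule theI')
  have "fast_reduces\<^sup>*\<^sup>* p q"
    using cs successively_rtranclp[of fast_reduces "contraction_sequence p"]
    by (auto simp: is_contraction_sequence_def q_def)
  then have q: "reduces\<^sup>*\<^sup>* p q"
    by (rule rtranclp_mono[THEN predicate2D, rotated]) (auto simp: fast_reduces_def)
  have end_cases: "irreducible_network q \<or> ambivalent p q"
    using cs by (auto simp: is_contraction_sequence_def q_def)
  have "unique_outcome p" if na: "\<not> ambivalent p q"
  proof -
    have "\<not> can_switch p q i" if "i \<in> pverts G" for i
      using na that by (auto simp: ambivalent_def)
    then have "unavoidable p q"
      using irreducible_eq_stable[OF p q] end_cases na by (auto simp: unavoidable_def)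
    then show ?thesis
      using reaches_social_networks[OF q p] by (auto simp: unique_outcome_def)
  qed
  then show ?thesis
    using ambivalent_not_unique_outcome[OF p q] unfolding q_def by blast
qed

end

theorem theorem6:
  fixes G :: "'v pair_pre_digraph"
    and w :: "'v \<times> 'v \<Rightarrow> real"
    and \<theta> :: "'v \<Rightarrow> real"
    and P :: "'p set"
    and p :: "'v \<Rightarrow> 'p set"
  assumes "threshold_setting G w \<theta> P"
    and "p \<in> threshold_setting.social_networks G P"
  shows "threshold_setting.unique_outcome G w \<theta> P p \<longleftrightarrow>
    \<not> threshold_setting.ambivalent G w \<theta> p
        (last (threshold_setting.contraction_sequence G w \<theta> P p))"
  using assms by (rule threshold_setting.unique_outcome_iff_contraction_sequence)

end
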